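(* If $G$ is a nice subcubic graph (i.e., a nice graph with maximum degree at most $3$), then $\mathrm{ch}_\Pi^*(G) \leq 4$.
   Context: Graphs are finite and simple. A graph is nice if it has no connected component isomorphic to $K_2$. A $k$-list assignment $L$ of $G$ assigns to every edge $e \in E(G)$ a set $L(e)$ of $k$ real numbers. An $L$-labelling is a map $\ell$ on $E(G)$ with $\ell(e) \in L(e)$ for every edge $e$. For a vertex $v$, set $\pi_\ell(v)=\prod_{w \in N(v)} \ell(vw)$. The labelling $\ell$ is p-proper if $\pi_\ell(u) \neq \pi_\ell(v)$ for every edge $uv$. $\mathrm{ch}_\Pi^*(G)$ is the smallest $k \geq 1$, if any, such that $G$ admits a p-proper $L$-labelling for every $k$-list assignment $L$ with $0 \notin L(e)$ for every edge $e$. *)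

theory Defs
  imports Complex_Main "HOL-Library.Extended_Nat"
begin

type_synonym 'a graph = "'a set \<times> 'a set set"

abbreviation verts :: "'a graph \<Rightarrow> 'a set" where
  "verts G \<equiv> fst G"

abbreviation edges :: "'a graph \<Rightarrow> 'a set set" where
  "edges G \<equiv> snd G"

definition finite_simple_graph :: "'a graph \<Rightarrow> bool" where
  "finite_simple_graph G \<longleftrightarrow>
     finite (verts G) \<and> (\<forall>e \<in> edges G. e \<subseteq> verts G \<and> card e = 2)"

definition neighbours :: "'a graph \<Rightarrow> 'a \<Rightarrow> 'a set" where
  "neighbours G v = {w. {v, w} \<in> edges G}"

definition degree :: "'a graph \<Rightarrow> 'a \<Rightarrow> nat" where
  "degree G v = card (neighbours G v)"

(* The inserted 0 only makes the maximum well-defined for the graph without vertices. *)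
definition max_degree :: "'a graph \<Rightarrow> nat" where
  "max_degree G = Max (insert 0 (degree G ` verts G))"

definition subcubic :: "'a graph \<Rightarrow> bool" where
  "subcubic G \<longleftrightarrow> max_degree G \<le> 3"

definition induced_subgraph :: "'a graph \<Rightarrow> 'a set \<Rightarrow> 'a graph" where
  "induced_subgraph G W = (W, {e \<in> edges G. e \<subseteq> W})"

definition reachable_from :: "'a graph \<Rightarrow> 'a \<Rightarrow> 'a set" where
  "reachable_from G v = {w. (v, w) \<in> {(x, y). {x, y} \<in> edges G}\<^sup>*}"

definition connected_components :: "'a graph \<Rightarrow> 'a graph set" where
  "connected_components G = (\<lambda>v. induced_subgraph G (reachable_from G v)) ` verts G"

definition graph_isomorphic :: "'a graph \<Rightarrow> 'b graph \<Rightarrow> bool" where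
  "graph_isomorphic G H \<longleftrightarrow>
     (\<exists>f. bij_betw f (verts G) (verts H) \<and>
       (\<forall>u \<in> verts G. \<forall>v \<in> verts G. {u, v} \<in> edges G \<longleftrightarrow> {f u, f v} \<in> edges H))"

definition K2 :: "nat graph" where
  "K2 = ({0, 1}, {{0, 1}})"

definition nice :: "'a graph \<Rightarrow> bool" where
  "nice G \<longleftrightarrow> \<not> (\<exists>C \<in> connected_components G. graph_isomorphic C K2)"

(* List assignments and labellings are total functions on sets of vertices; only their
   values on edges of G are ever constrained or used. *)
definition list_assignment :: "'a graph \<Rightarrow> nat \<Rightarrow> ('a set \<Rightarrow> real set) \<Rightarrow> bool" where
  "list_assignment G k L \<longleftrightarrow> (\<forall>e \<in> edges G. finite (L e) \<and> card (L e) = k)"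

definition list_labelling ::
    "'a graph \<Rightarrow> ('a set \<Rightarrow> real set) \<Rightarrow> ('a set \<Rightarrow> real) \<Rightarrow> bool" where
  "list_labelling G L l \<longleftrightarrow> (\<forall>e \<in> edges G. l e \<in> L e)"

definition vertex_product :: "'a graph \<Rightarrow> ('a set \<Rightarrow> real) \<Rightarrow> 'a \<Rightarrow> real" where
  "vertex_product G l v = (\<Prod>w \<in> neighbours G v. l {v, w})"

definition p_proper :: "'a graph \<Rightarrow> ('a set \<Rightarrow> real) \<Rightarrow> bool" where
  "p_proper G l \<longleftrightarrow>
     (\<forall>u v. {u, v} \<in> edges G \<longrightarrow> vertex_product G l u \<noteq> vertex_product G l v)"

(* Every nonempty set of extended naturals contains its infimum, so this is the smallest
   admissible k, with value \<infinity> exactly when no k is admissible. *)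
definition ch_Pi_star :: "'a graph \<Rightarrow> enat" where
  "ch_Pi_star G = Inf (enat ` {k. 1 \<le> k \<and>
     (\<forall>L. list_assignment G k L \<and> (\<forall>e \<in> edges G. 0 \<notin> L e) \<longrightarrow>
       (\<exists>l. list_labelling G L l \<and> p_proper G l))})"

end

theory Submission
  imports Defs
begin

text \<open>
The label of \<open>uv\<close> cancels in the condition at \<open>uv\<close>, so that condition involves only the at most four edges
adjacent to \<open>uv\<close>, and it excludes at most one value for the last of them to be labelled. Work in one
component and label edges in order of decreasing distance from a small set \<open>U\<close> of edges: an edge outside \<open>U\<close> has a
neighbour closer to \<open>U\<close> whose condition is still open, so at most three of its four values are excluded.

If some edge has at most three adjacent edges, one can end with this edge and a neighbour of it. Otherwise the component is
cubic, and the three edges at a suitable vertex \<open>z\<close> with neighbours \<open>a\<close>, \<open>b\<close>, \<open>c\<close> are labelled last.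
If exactly two of \<open>a\<close>, \<open>b\<close>, \<open>c\<close> are adjacent, this always succeeds. If none are, then failure leaves exactly two candidates
for each edge at \<open>z\<close>, paired up by the conditions, and relabelling another edge at \<open>a\<close> destroys this pairing.
In a cubic component other than \<open>K\<^sub>4\<close>, a vertex of one of these two kinds exists, and \<open>K\<^sub>4\<close> is treated directly.
\<close>

section \<open>Choosing values from finite sets of reals\<close>

lemma exists_avoiding:
  assumes "finite A" "card A < card (M :: 'b set)"
  shows "\<exists>x\<in>M. x \<notin> A"
  using assms by (meson card_mono leD subsetI)

text \<open>If \<open>B / x\<close> were missing from \<open>M3\<close>, the equation
  \<open>x * z = B\<close> could never hold; picking \<open>y\<close> off \<open>C / x\<close> and
  then \<open>z\<close> off \<open>A / y\<close> would escape the other two.\<close>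

lemma triple_matching:
  fixes M1 M2 M3 :: "real set"
  assumes "2 \<le> card M2" "2 \<le> card M3" "0 \<notin> M1" "0 \<notin> M2"
    and blocked: "\<forall>x\<in>M1. \<forall>y\<in>M2. \<forall>z\<in>M3. y * z = A \<or> x * z = B \<or> x * y = C"
    and "x \<in> M1"
  shows "B / x \<in> M3"
proof (rule ccontr)
  assume no: "B / x \<notin> M3"
  obtain y where y: "y \<in> M2" "y \<noteq> C / x" using exists_avoiding[of "{C / x}" M2] assms(1) by auto
  obtain z where z: "z \<in> M3" "z \<noteq> A / y" using exists_avoiding[of "{A / y}" M3] assms(2) by auto
  have "x \<noteq> 0" "y \<noteq> 0" using assms(3,4,6) y by auto
  then have "y * z \<noteq> A" "x * y \<noteq> C" "x * z \<noteq> B"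
    using y(2) z no by (auto simp: eq_divide_eq mult.commute)
  then show False using blocked assms(6) y z by blast
qed

text \<open>Meant for the labels \<open>x\<close>, \<open>y\<close>, \<open>z\<close> of the three
  edges of a star, each equation being the failure of the condition at one of them. By
  \<open>triple_matching\<close> in both directions, dividing \<open>B\<close> by a label exchanges
  \<open>M1\<close> and \<open>M3\<close>. A third element of \<open>M3\<close> would let
  \<open>z\<close> avoid \<open>A / y\<close> and \<open>B / x\<close> at once.\<close>

lemma triple_blocked:
  fixes M1 M2 M3 :: "real set"
  assumes card: "2 \<le> card M1" "2 \<le> card M2" "2 \<le> card M3"
    and zero: "0 \<notin> M1" "0 \<notin> M2" "0 \<notin> M3" and "B \<noteq> 0"
    and blocked: "\<forall>x\<in>M1. \<forall>y\<in>M2. \<forall>z\<in>M3. y * z = A \<or> x * z = B \<or> x * y = C"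
  shows "M1 = (\<lambda>z. B / z) ` M3" and "card M1 = 2"
proof -
  have 13: "B / x \<in> M3" if "x \<in> M1" for x
    using triple_matching[OF card(2,3) zero(1,2) blocked that] .
  \<comment> \<open>The same lemma with \<open>M1\<close> and \<open>M3\<close>, and also
    \<open>A\<close> and \<open>C\<close>, exchanged.\<close>
  have 31: "B / z \<in> M1" if "z \<in> M3" for z
    using triple_matching[of M2 M1 M3 C B A z] card zero blocked that by (metis mult.commute)
  show M1: "M1 = (\<lambda>z. B / z) ` M3"
  proof
    show "(\<lambda>z. B / z) ` M3 \<subseteq> M1" using 31 by auto
    show "M1 \<subseteq> (\<lambda>z. B / z) ` M3"
    proof
      fix x assume x: "x \<in> M1"
      have "x = B / (B / x)" using x zero(1) \<open>B \<noteq> 0\<close> by auto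
      then show "x \<in> (\<lambda>z. B / z) ` M3" using 13[OF x] by blast
    qed
  qed
  have fin: "finite M3" using card(3) by (metis card.infinite not_numeral_le_zero)
  have "card M1 \<le> card M3" using M1 fin by (metis card_image_le)
  show "card M1 = 2"
  proof (rule ccontr)
    assume "card M1 \<noteq> 2"
    then have "3 \<le> card M3" using card(1) \<open>card M1 \<le> card M3\<close> by linarith
    obtain x where x: "x \<in> M1" using card(1) by fastforce
    obtain y where y: "y \<in> M2" "y \<noteq> C / x" using exists_avoiding[of "{C / x}" M2] card(2) by auto
    have "card {A / y, B / x} \<le> 2" by (simp add: card_insert_if)
    then obtain z where z: "z \<in> M3" "z \<noteq> A / y" "z \<noteq> B / x"
      using exists_avoiding[of "{A / y, B / x}" M3] \<open>3 \<le> card M3\<close> by auto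
    have "x \<noteq> 0" "y \<noteq> 0" using x y zero by auto
    then have "y * z \<noteq> A" "x * y \<noteq> C" "x * z \<noteq> B" using y(2) z(2,3) by (auto simp: eq_divide_eq mult.commute)
    then show False using blocked x y z by blast
  qed
qed

text \<open>Meant for a star with two adjacent leaves: \<open>t\<close> labels the edge joining
  them, \<open>p\<close> and \<open>q\<close> label the remaining edges at these leaves. The first
  three inequalities are the conditions at the star edges, the last one is the condition at the
  joining edge.\<close>

lemma triple_with_ratio:
  fixes M1 M2 M3 :: "real set"
  assumes card: "3 \<le> card M1" "3 \<le> card M2" "2 \<le> card M3"
    and zero: "0 \<notin> M1" "0 \<notin> M2" "0 \<notin> M3" and nz: "p \<noteq> 0" "q \<noteq> 0" "t \<noteq> 0"
  shows "\<exists>x\<in>M1. \<exists>y\<in>M2. \<exists>z\<in>M3. y * z \<noteq> t * p \<and> x * z \<noteq> t * q \<and> x * y \<noteq> C \<and> x * p \<noteq> y * q"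
proof (rule ccontr)
  assume "\<not> ?thesis"
  then have blocked: "y * z = t * p \<or> x * z = t * q \<or> x * y = C \<or> x * p = y * q"
    if "x \<in> M1" "y \<in> M2" "z \<in> M3" for x y z using that by blast
  \<comment> \<open>Otherwise \<open>x * z = t * q\<close> is impossible; \<open>y\<close> can avoid
    \<open>t * p / z\<close>, and the three elements of \<open>M1\<close> leave an \<open>x\<close>
    that avoids both \<open>C / y\<close> and \<open>y * q / p\<close>.\<close>
  have in_M1: "t * q / z \<in> M1" if z: "z \<in> M3" for z
  proof (rule ccontr)
    assume no: "t * q / z \<notin> M1"
    obtain y where y: "y \<in> M2" "y \<noteq> t * p / z"
      using exists_avoiding[of "{t * p / z}" M2] card(2) by auto
    have "card {C / y, y * q / p} \<le> 2" by (simp add: card_insert_if)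
    then obtain x where x: "x \<in> M1" "x \<noteq> C / y" "x \<noteq> y * q / p"
      using exists_avoiding[of "{C / y, y * q / p}" M1] card(1) by auto
    have nz': "x \<noteq> 0" "y \<noteq> 0" "z \<noteq> 0" using x y z zero by auto
    have "y * z \<noteq> t * p" using y(2) nz' by (auto simp: eq_divide_eq)
    moreover have "x * z \<noteq> t * q" using no x(1) nz' by (metis nonzero_mult_div_cancel_right)
    moreover have "x * y \<noteq> C" "x * p \<noteq> y * q" using x(2,3) nz' nz by (auto simp: eq_divide_eq)
    ultimately show False using blocked[OF x(1) y(1) z] by blast
  qed
  obtain z z' where z: "z \<in> M3" "z' \<in> M3" "z \<noteq> z'"
  proof -
    obtain z where z: "z \<in> M3" using card(3) by fastforce
    then show ?thesis using that exists_avoiding[of "{z}" M3] card(3) by auto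
  qed
  have "card {t * p / z, t * p / z'} \<le> 2" by (simp add: card_insert_if)
  then obtain y where y: "y \<in> M2" "y \<noteq> t * p / z" "y \<noteq> t * p / z'"
    using exists_avoiding[of "{t * p / z, t * p / z'}" M2] card(2) by auto
  have nz': "y \<noteq> 0" "z \<noteq> 0" "z' \<noteq> 0" using y z zero by auto
  \<comment> \<open>With \<open>x = t * q / z\<close>, the equation \<open>x * p = y * q\<close>
    amounts to \<open>y = t * p / z\<close>, which is excluded, and \<open>x * z' = t * q\<close>
    would force \<open>z = z'\<close>. Only \<open>x * y = C\<close> remains. By symmetry it also
    holds for \<open>x = t * q / z'\<close>, so one \<open>y\<close> would have two
    partners.\<close>
  have "t * q / z * y = C"
    using blocked[OF in_M1[OF z(1)] y(1) z(2)] y(2,3) nz nz' z(3) by (auto simp: eq_divide_eq divide_eq_eq mult_ac)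
  moreover have "t * q / z' * y = C"
    using blocked[OF in_M1[OF z(2)] y(1) z(1)] y(2,3) nz nz' z(3) by (auto simp: eq_divide_eq divide_eq_eq mult_ac)
  ultimately have "t * q / z * y = t * q / z' * y" by simp
  then show False using nz nz' z(3) by (simp add: field_simps)
qed

text \<open>As \<open>K\<close> has at least three elements and only two survive, each
  \<open>y\<close> really removes an element, namely \<open>\<kappa> / y\<close>. Distinct
  \<open>y\<close> remove distinct elements, and \<open>K\<close> has only three of them once
  \<open>Y\<close> is nonempty.\<close>

lemma varying_exclusion:
  fixes K Y :: "real set"
  assumes "3 \<le> card K" "0 \<notin> Y" "\<kappa> \<noteq> 0"
    and two: "\<forall>y\<in>Y. card {x \<in> K. x * y \<noteq> \<kappa>} = 2"
  shows "card Y \<le> 3"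
    and "\<lbrakk>y \<in> Y; y' \<in> Y; {x \<in> K. x * y \<noteq> \<kappa>} = {x \<in> K. x * y' \<noteq> \<kappa>}\<rbrakk> \<Longrightarrow> y = y'"
proof -
  have fin: "finite K" using assms(1) by (metis card.infinite not_numeral_le_zero)
  have in_K: "\<kappa> / y \<in> K" if "y \<in> Y" for y
  proof (rule ccontr)
    assume "\<kappa> / y \<notin> K"
    moreover have "y \<noteq> 0" using that assms(2) by auto
    ultimately have "{x \<in> K. x * y \<noteq> \<kappa>} = K" by (auto simp: field_simps)
    then show False using two that assms(1) by force
  qed
  show "y = y'" if "y \<in> Y" "y' \<in> Y" "{x \<in> K. x * y \<noteq> \<kappa>} = {x \<in> K. x * y' \<noteq> \<kappa>}"
  proof -
    have "y \<noteq> 0" "y' \<noteq> 0" using that assms(2) by auto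
    moreover have "\<kappa> / y \<notin> {x \<in> K. x * y \<noteq> \<kappa>}" using \<open>y \<noteq> 0\<close> by simp
    then have "\<kappa> / y * y' = \<kappa>" using that(3) in_K[OF that(1)] by blast
    ultimately show ?thesis using assms(3) by (simp add: field_simps)
  qed
  show "card Y \<le> 3"
  proof (cases "Y = {}")
    case False
    then obtain y where y: "y \<in> Y" by blast
    then have "y \<noteq> 0" using assms(2) by auto
    then have "K = insert (\<kappa> / y) {x \<in> K. x * y \<noteq> \<kappa>}" using in_K[OF y] by (auto simp: field_simps)
    then have "card K \<le> 3" using two y fin
      by (metis (no_types, lifting) Suc_eq_plus1 card_insert_le_m1 diff_Suc_1 eval_nat_numeral(3)
          card_insert_if finite_insert le_refl le_SucI)
    moreover have "inj_on (\<lambda>y. \<kappa> / y) Y" using assms(2,3) by (auto simp: inj_on_def field_simps)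
    then have "card Y \<le> card K" using in_K fin by (metis card_inj_on_le image_subsetI)
    ultimately show ?thesis by linarith
  qed simp
qed

text \<open>Only the ratios \<open>a / a'\<close>, \<open>b / b'\<close>, \<open>c / c'\<close> matter, up to inversion. If \<open>c'\<close> leaves no room for \<open>c\<close>,
  then \<open>C\<close> consists of \<open>c'\<close> times two ratios and their inverses, so the product of \<open>C\<close> is \<open>c' ^ 4\<close>;
  this can happen for at most two values of \<open>c'\<close>.\<close>
lemma K4_choice:
  fixes A A' B B' C C' :: "real set"
  assumes card: "card A = 4" "card A' = 4" "card B = 4" "card B' = 4" "card C = 4" "card C' = 4"
    and zero: "0 \<notin> A" "0 \<notin> A'" "0 \<notin> B" "0 \<notin> B'" "0 \<notin> C'"
  obtains a a' b b' c c' where "a \<in> A" "a' \<in> A'" "b \<in> B" "b' \<in> B'" "c \<in> C" "c' \<in> C'"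
    "a * b \<noteq> a' * b'" "a * b' \<noteq> a' * b" "a * c \<noteq> a' * c'" "a * c' \<noteq> a' * c"
    "b * c \<noteq> b' * c'" "b * c' \<noteq> b' * c"
proof -
  obtain a a' b' where a: "a \<in> A" "a' \<in> A'" "b' \<in> B'" using card(1,2,4) by fastforce
  have "card {a' * b' / a, a * b' / a'} \<le> 2" by (simp add: card_insert_if)
  then obtain b where b: "b \<in> B" "b \<noteq> a' * b' / a" "b \<noteq> a * b' / a'"
    using exists_avoiding[of "{a' * b' / a, a * b' / a'}" B] card(3) by auto
  have nz: "a \<noteq> 0" "a' \<noteq> 0" "b \<noteq> 0" "b' \<noteq> 0" using a b zero by auto
  have ab: "a * b \<noteq> a' * b'" "a * b' \<noteq> a' * b" using b(2,3) nz by (auto simp: eq_divide_eq mult_ac)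
  define F where "F c' = {a' * c' / a, a * c' / a', b' * c' / b, b * c' / b'}" for c'
  have "\<exists>c'\<in>C'. \<not> C \<subseteq> F c'"
  proof (rule ccontr)
    assume "\<not> ?thesis"
    then have sub: "C \<subseteq> F c'" if "c' \<in> C'" for c' using that by blast
    have pow: "c' ^ 4 = \<Prod>C" if "c' \<in> C'" for c'
    proof -
      have "card (F c') \<le> 4" by (simp add: F_def card_insert_if)
      then have eq: "C = F c'" using card_seteq[of "F c'" C] sub[OF that] card(5) by (simp add: F_def)
      then have "card (F c') = 4" using card(5) by simp
      \<comment> \<open>Cardinality 4 makes the four listed values distinct, so the product over the
        set has all four factors.\<close>
      then have "\<Prod>(F c') = (a' * c' / a) * (a * c' / a') * (b' * c' / b) * (b * c' / b')"
        unfolding F_def by (auto simp: card_insert_if split: if_splits)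
      also have "\<dots> = c' ^ 4" using nz by (simp add: field_simps power4_eq_xxxx)
      finally show ?thesis using eq by simp
    qed
    obtain d where d: "d \<in> C'" using card(6) by fastforce
    have "C' \<subseteq> {d, - d}"
    proof
      fix c' assume "c' \<in> C'"
      then have "c' ^ 4 = d ^ 4" using pow d by simp
      then have "\<bar>c'\<bar> = \<bar>d\<bar>" by (metis abs_ge_zero power_abs power_eq_iff_eq_base zero_less_numeral)
      then show "c' \<in> {d, - d}" by auto
    qed
    then have "card C' \<le> card {d, - d}" by (intro card_mono) auto
    also have "\<dots> \<le> 2" by (simp add: card_insert_if)
    finally show False using card(6) by simp
  qed
  then obtain c c' where c: "c' \<in> C'" "c \<in> C" "c \<notin> F c'" by blast
  then have "c' \<noteq> 0" using zero by auto
  have "a * c \<noteq> a' * c'" "a * c' \<noteq> a' * c" "b * c \<noteq> b' * c'" "b * c' \<noteq> b' * c"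
    using c(3) nz by (auto simp: F_def eq_divide_eq mult_ac)
  then show thesis using that a b(1) c ab by blast
qed

section \<open>Edges and their conditions in a single component\<close>

text \<open>One component, given by its edge set alone. Niceness becomes
  \<open>not_isolated\<close>, and connectedness is stated for sets of edges, the form in which the
  labelling order is built.\<close>

locale nice_subcubic =
  fixes E :: "'a set set" and L :: "'a set \<Rightarrow> real set"
  assumes finite_E: "finite E"
    and card_edge: "e \<in> E \<Longrightarrow> card e = 2"
    and card_incident: "card {e \<in> E. v \<in> e} \<le> 3"
    and not_isolated: "e \<in> E \<Longrightarrow> \<exists>f\<in>E. f \<noteq> e \<and> f \<inter> e \<noteq> {}"
    and connected: "\<lbrakk>U \<subseteq> E; U \<noteq> {}; U \<noteq> E\<rbrakk> \<Longrightarrow> \<exists>f\<in>E - U. \<exists>g\<in>U. f \<inter> g \<noteq> {}"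
    and finite_L: "e \<in> E \<Longrightarrow> finite (L e)"
    and card_L: "e \<in> E \<Longrightarrow> card (L e) = 4"
    and zero_L: "e \<in> E \<Longrightarrow> 0 \<notin> L e"
begin

definition inc :: "'a \<Rightarrow> 'a set set" where
  "inc v = {e \<in> E. v \<in> e}"

definition nb :: "'a set \<Rightarrow> 'a set set" where
  "nb e = {f \<in> E. f \<noteq> e \<and> f \<inter> e \<noteq> {}}"

definition labelling :: "('a set \<Rightarrow> real) \<Rightarrow> bool" where
  "labelling l \<longleftrightarrow> (\<forall>e\<in>E. l e \<in> L e)"

definition good :: "('a set \<Rightarrow> real) \<Rightarrow> 'a set \<Rightarrow> bool" where
  "good l e \<longleftrightarrow> (\<forall>u v. e = {u, v} \<longrightarrow> prod l (inc u) \<noteq> prod l (inc v))"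

text \<open>The edges of \<open>U\<close> are those still to be labelled for good, although
  \<open>l\<close> is total. A condition is demanded as soon as all adjacent edges have their final
  label; whether the edge itself lies in \<open>U\<close> is irrelevant because its own label
  cancels.\<close>

definition stage :: "'a set set \<Rightarrow> ('a set \<Rightarrow> real) \<Rightarrow> bool" where
  "stage U l \<longleftrightarrow> labelling l \<and> (\<forall>e\<in>E. nb e \<inter> U = {} \<longrightarrow> good l e)"

lemma finite_inc [simp]: "finite (inc v)"
  using finite_E by (simp add: inc_def)

lemma finite_nb [simp]: "finite (nb e)"
  using finite_E by (simp add: nb_def)

lemma nb_sym: "\<lbrakk>e \<in> E; f \<in> nb e\<rbrakk> \<Longrightarrow> e \<in> nb f"
  by (auto simp: nb_def)

lemma nb_subset: "nb e \<subseteq> E"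
  by (auto simp: nb_def)

lemma nb_nonempty: "e \<in> E \<Longrightarrow> nb e \<noteq> {}"
  using not_isolated by (fastforce simp: nb_def)

lemma edge_distinct: "{u, v} \<in> E \<Longrightarrow> u \<noteq> v"
  using card_edge[of "{u, v}"] by auto

lemma edge_obtain:
  assumes "e \<in> E" obtains u v where "e = {u, v}" "u \<noteq> v"
  using card_edge[OF assms] by (auto simp: card_2_iff)

lemma edge_eqI: "\<lbrakk>f \<in> E; u \<in> f; v \<in> f; u \<noteq> v\<rbrakk> \<Longrightarrow> f = {u, v}"
  by (metis edge_obtain insertE insert_commute singletonD)

lemma nb_eq:
  assumes "{u, v} \<in> E"
  shows "nb {u, v} = (inc u - {{u, v}}) \<union> (inc v - {{u, v}})"
  using assms by (auto simp: nb_def inc_def)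

lemma card_nb_le:
  assumes "{u, v} \<in> E"
  shows "card (nb {u, v}) + 2 \<le> card (inc u) + card (inc v)"
proof -
  have "{u, v} \<in> inc u" "{u, v} \<in> inc v" using assms by (auto simp: inc_def)
  then have "Suc (card (inc u - {{u, v}})) = card (inc u)" "Suc (card (inc v - {{u, v}})) = card (inc v)"
    using card_Suc_Diff1[OF finite_inc] by blast+
  then show ?thesis
    using nb_eq[OF assms] card_Un_le[of "inc u - {{u, v}}" "inc v - {{u, v}}"] by simp
qed

lemma card_inc_le: "card (inc v) \<le> 3"
  using card_incident by (simp add: inc_def)

lemma card_nb_le_4:
  assumes "e \<in> E"
  shows "card (nb e) \<le> 4"
proof -
  obtain u v where e: "e = {u, v}" using edge_obtain[OF assms] by metis
  show ?thesis
    using card_nb_le[of u v] card_inc_le[of u] card_inc_le[of v] assms unfolding e by linarith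
qed

lemma prod_upd:
  assumes "f \<in> inc v"
  shows "prod (l(f := y)) (inc v) = y * prod l (inc v - {f})"
  by (subst prod.remove[OF finite_inc assms]) (auto intro!: prod.cong)

lemma prod_upd_other:
  assumes "f \<notin> inc v"
  shows "prod (l(f := y)) (inc v) = prod l (inc v)"
  using assms by (auto intro!: prod.cong)

lemma labelling_nonzero: "\<lbrakk>labelling l; A \<subseteq> E\<rbrakk> \<Longrightarrow> prod l A \<noteq> 0"
  using zero_L finite_subset[OF _ finite_E]
  by (fastforce simp: labelling_def prod_zero_iff)

lemma labelling_upd: "\<lbrakk>labelling l; y \<in> L f\<rbrakk> \<Longrightarrow> labelling (l(f := y))"
  by (simp add: labelling_def)

lemma inc_subset: "inc v \<subseteq> E"
  by (auto simp: inc_def)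

lemma good_iff: "good l {u, v} \<longleftrightarrow> prod l (inc u) \<noteq> prod l (inc v)"
  by (auto simp: good_def doubleton_eq_iff)

text \<open>The label of \<open>e\<close> is a nonzero factor of the products at both of its
  ends.\<close>

lemma good_upd_self:
  assumes "e \<in> E" "l e \<noteq> 0" "y \<noteq> 0"
  shows "good (l(e := y)) e \<longleftrightarrow> good l e"
proof -
  obtain u v where e: "e = {u, v}" using edge_obtain assms(1) by metis
  have in_inc: "e \<in> inc u" "e \<in> inc v" using assms e by (auto simp: inc_def)
  show ?thesis
    using assms(2,3) unfolding e good_iff
    using in_inc e prod.remove[OF finite_inc in_inc(1), of l] prod.remove[OF finite_inc in_inc(2), of l]
    by (simp add: prod_upd del: fun_upd_apply)
qed

lemma good_upd_other:
  assumes "e \<in> E" "f \<notin> nb e" "f \<noteq> e" "f \<in> E"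
  shows "good (l(f := y)) e \<longleftrightarrow> good l e"
proof -
  obtain u v where e: "e = {u, v}" using edge_obtain assms(1) by metis
  have "f \<notin> inc u" "f \<notin> inc v" using assms e by (auto simp: inc_def nb_def)
  then show ?thesis by (simp add: e good_iff prod_upd_other del: fun_upd_apply)
qed

lemma good_upd:
  assumes "e \<in> E" "f \<in> E" "f \<notin> nb e" "l f \<noteq> 0" "y \<noteq> 0"
  shows "good (l(f := y)) e \<longleftrightarrow> good l e"
  using assms good_upd_self good_upd_other by (cases "f = e") auto

text \<open>In a simple graph \<open>f\<close> meets \<open>e\<close> in exactly one end, so the new
  label scales just one of the two products, by a nonzero cofactor.\<close>

lemma bad_unique:
  assumes "e \<in> E" "f \<in> nb e" "labelling l"
    and "\<not> good (l(f := y)) e" "\<not> good (l(f := y')) e"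
  shows "y = y'"
proof -
  obtain u where u: "u \<in> e" "u \<in> f" using assms(2) by (auto simp: nb_def)
  obtain v where e: "e = {u, v}" using edge_obtain[OF assms(1)] u(1) by blast
  have f: "f \<in> E" "f \<noteq> e" using assms(2) by (auto simp: nb_def)
  have "v \<notin> f" using edge_eqI[of f u v] edge_distinct[of u v] f e u assms(1) by auto
  then have inc: "f \<in> inc u" "f \<notin> inc v" using f u by (auto simp: inc_def)
  have nz: "prod l (inc u - {f}) \<noteq> 0"
    using labelling_nonzero[OF assms(3), of "inc u - {f}"] inc_subset by blast
  have "y * prod l (inc u - {f}) = y' * prod l (inc u - {f})"
    using assms(4,5) by (simp add: e good_iff prod_upd[OF inc(1)] prod_upd_other[OF inc(2)] del: fun_upd_apply)
  then show ?thesis using nz by simp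
qed

section \<open>Labelling in stages\<close>

lemma free_choices:
  assumes "labelling l" "f \<in> E" "F \<subseteq> nb f"
  shows "4 \<le> card {y \<in> L f. \<forall>e\<in>F. good (l(f := y)) e} + card F"
proof -
  let ?Y = "{y \<in> L f. \<forall>e\<in>F. good (l(f := y)) e}"
  let ?bad = "\<lambda>e. {y \<in> L f. \<not> good (l(f := y)) e}"
  have fin: "finite F" using assms(3) finite_nb finite_subset by blast
  have "card (?bad e) \<le> 1" if "e \<in> F" for e
  proof (rule card_le_Suc0_iff_eq[THEN iffD2, folded One_nat_def])
    show "finite (?bad e)" using finite_L[OF assms(2)] by simp
    have "e \<in> E" "f \<in> nb e" using that assms nb_sym nb_subset by blast+
    then show "\<forall>x\<in>?bad e. \<forall>y\<in>?bad e. x = y" using bad_unique assms(1) by blast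
  qed
  then have "card (\<Union>e\<in>F. ?bad e) \<le> card F"
    using card_UN_le[OF fin, of ?bad] sum_bounded_above[of F "\<lambda>e. card (?bad e)" 1]
    by (metis (no_types, lifting) mult.right_neutral of_nat_id order_trans)
  moreover have "L f = ?Y \<union> (\<Union>e\<in>F. ?bad e)" by auto
  then have "card (L f) \<le> card ?Y + card (\<Union>e\<in>F. ?bad e)"
    using card_Un_le[of ?Y "\<Union>e\<in>F. ?bad e"] by (simp only:)
  ultimately show ?thesis using card_L[OF assms(2)] by linarith
qed

text \<open>Only conditions at edges adjacent to \<open>f\<close> that become due when
  \<open>f\<close> leaves the unfinished set can exclude a label. Every other due condition,
  including one at \<open>f\<close> itself, was due before and is untouched by the change.\<close>

lemma stage_step:
  assumes "stage (insert f U) l" "f \<in> E"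
  shows "4 \<le> card {y \<in> L f. stage U (l(f := y))} + card {e \<in> nb f. nb e \<inter> U = {}}"
proof -
  let ?F = "{e \<in> nb f. nb e \<inter> U = {}}"
  have lab: "labelling l" using assms(1) by (simp add: stage_def)
  have nz: "l f \<noteq> 0" using lab assms(2) zero_L by (metis labelling_def)
  have "{y \<in> L f. \<forall>e\<in>?F. good (l(f := y)) e} \<subseteq> {y \<in> L f. stage U (l(f := y))}"
  proof (clarsimp simp: stage_def, intro conjI ballI impI)
    fix y assume y: "y \<in> L f" "\<forall>e. e \<in> nb f \<and> nb e \<inter> U = {} \<longrightarrow> good (l(f := y)) e"
    show "labelling (l(f := y))" using lab y labelling_upd by blast
    fix e assume e: "e \<in> E" "nb e \<inter> U = {}"
    show "good (l(f := y)) e"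
    proof (cases "f \<in> nb e")
      case True
      then show ?thesis using y e nb_sym by blast
    next
      case False
      then have "good l e" using e assms(1) by (auto simp: stage_def)
      moreover have "y \<noteq> 0" using y zero_L assms(2) by metis
      ultimately show ?thesis using good_upd[of e f l y] False e assms(2) nz by simp
    qed
  qed
  then have "card {y \<in> L f. \<forall>e\<in>?F. good (l(f := y)) e} \<le> card {y \<in> L f. stage U (l(f := y))}"
    using finite_L[OF assms(2)] by (intro card_mono) auto
  then show ?thesis using free_choices[OF lab assms(2), of ?F] by auto
qed

lemma stage_remove:
  assumes "stage (insert f U) l" "f \<in> E" "card {e \<in> nb f. nb e \<inter> U = {}} \<le> 3"
  shows "\<exists>l. stage U l"
proof -
  have "{y \<in> L f. stage U (l(f := y))} \<noteq> {}"
  proof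
    assume "{y \<in> L f. stage U (l(f := y))} = {}"
    then have "card {y \<in> L f. stage U (l(f := y))} = 0" by (simp only: card.empty)
    then show False using stage_step[OF assms(1,2)] assms(3) by linarith
  qed
  then show ?thesis by auto
qed

text \<open>Induction on the number of edges outside \<open>U\<close>. An edge \<open>f\<close>
  touching some \<open>g\<close> in \<open>U\<close> joins the unfinished set, the remaining edges
  are labelled first, and then \<open>f\<close> is labelled. Since \<open>g\<close> has a neighbour
  in \<open>U\<close>, its condition is still open at that moment, so at most three labels of
  \<open>f\<close> are excluded.\<close>

lemma stage_exists:
  assumes "U \<subseteq> E" "U \<noteq> {}" "\<forall>g\<in>U. nb g \<inter> U \<noteq> {}"
  shows "\<exists>l. stage U l"
  using assms
proof (induction "card (E - U)" arbitrary: U rule: less_induct)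
  case less
  show ?case
  proof (cases "U = E")
    case True
    have "\<forall>e. \<exists>y. e \<in> E \<longrightarrow> y \<in> L e" using card_L by (metis all_not_in_conv card.empty zero_neq_numeral)
    then obtain l where "\<forall>e\<in>E. l e \<in> L e" by metis
    \<comment> \<open>Every edge has an adjacent edge in \<open>E\<close>, so no condition is due
      yet.\<close>
    then have "stage E l"
      using nb_nonempty by (simp add: stage_def labelling_def Int_absorb2[OF nb_subset])
    then show ?thesis using True by auto
  next
    case False
    obtain f g where fg: "f \<in> E - U" "g \<in> U" "f \<inter> g \<noteq> {}"
      using connected[OF less.prems(1,2) False] by blast
    then have nb: "g \<in> nb f" "f \<in> nb g" using less.prems(1) by (auto simp: nb_def)
    have "card (E - insert f U) < card (E - U)"
      using fg finite_E by (intro psubset_card_mono) auto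
    moreover have "\<forall>h\<in>insert f U. nb h \<inter> insert f U \<noteq> {}" using less.prems(3) nb fg by blast
    ultimately obtain l where l: "stage (insert f U) l"
      using less.hyps[of "insert f U"] less.prems fg by auto
    have "{e \<in> nb f. nb e \<inter> U = {}} \<subseteq> nb f - {g}" using less.prems(3) fg by auto
    then have "card {e \<in> nb f. nb e \<inter> U = {}} \<le> card (nb f - {g})" by (intro card_mono) auto
    also have "\<dots> \<le> 3" using card_nb_le_4[of f] nb fg by (simp add: card_Diff_singleton)
    finally show ?thesis using stage_remove[OF l] fg by auto
  qed
qed

section \<open>Components having an edge with at most three adjacent edges\<close>

text \<open>The last two edges labelled are \<open>e\<close> and then \<open>r\<close>. For
  \<open>r\<close> there are at most three conditions in all; for \<open>e\<close> one must find an
  adjacent edge whose condition waits for \<open>r\<close>, or show that \<open>e\<close> has few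
  adjacent edges.\<close>

lemma noncubic:
  assumes r: "r \<in> E" "card (nb r) \<le> 3"
  shows "\<exists>l. stage {} l"
proof -
  obtain e where e: "e \<in> nb r" using nb_nonempty r by blast
  then have eE: "e \<in> E" and re: "r \<in> nb e" using nb_subset nb_sym r by blast+
  obtain l where l: "stage {e, r} l"
    using stage_exists[of "{e, r}"] e re eE r by auto
  have "card {f \<in> nb e. nb f \<inter> {r} = {}} \<le> 3"
  proof -
    obtain s where s: "s \<in> e" "s \<in> r" using e by (auto simp: nb_def)
    obtain w where w: "e = {s, w}" using edge_obtain[OF eE] s by (metis insertE insert_commute singletonD)
    show ?thesis
    proof (cases "card (inc s) = 3")
      case True
      \<comment> \<open>The third edge \<open>h\<close> at the common end \<open>s\<close> is
        adjacent to both \<open>e\<close> and \<open>r\<close>, so its condition stays open until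
        \<open>r\<close> is labelled.\<close>
      have "card {r, e} < card (inc s)" using True by (simp add: card_insert_if)
      then have "\<not> inc s \<subseteq> {r, e}" by (metis card_mono finite.emptyI finite.insertI leD)
      then obtain h where h: "h \<in> inc s" "h \<noteq> r" "h \<noteq> e" by auto
      then have hh: "h \<in> nb e" "r \<in> nb h" using s r by (auto simp: nb_def inc_def)
      have "card {f \<in> nb e. nb f \<inter> {r} = {}} \<le> card (nb e - {h})"
        using hh by (intro card_mono) auto
      also have "\<dots> \<le> 3" using card_nb_le_4[OF eE] hh by (simp add: card_Diff_singleton)
      finally show ?thesis .
    next
      case False
      then have "card (nb e) \<le> 3"
        using card_nb_le[of s w] card_inc_le[of s] card_inc_le[of w] eE w by auto
      moreover have "card {f \<in> nb e. nb f \<inter> {r} = {}} \<le> card (nb e)"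
        by (intro card_mono) auto
      ultimately show ?thesis by linarith
    qed
  qed
  then obtain l where "stage {r} l" using stage_remove[OF l eE] by auto
  then show ?thesis using stage_remove[of r "{}" l] r by auto
qed

section \<open>Stars: the three edges at a vertex of degree three\<close>

definition star :: "'a \<Rightarrow> 'a \<Rightarrow> 'a \<Rightarrow> 'a \<Rightarrow> bool" where
  "star z a b c \<longleftrightarrow> distinct [z, a, b, c] \<and> inc z = {{z, a}, {z, b}, {z, c}}"

definition allowed :: "('a set \<Rightarrow> real) \<Rightarrow> 'a set \<Rightarrow> 'a set set \<Rightarrow> real set" where
  "allowed l f F = {x \<in> L f. \<forall>e\<in>F. good (l(f := x)) e}"

lemma card_allowed:
  "\<lbrakk>labelling l; f \<in> E; F \<subseteq> nb f\<rbrakk> \<Longrightarrow> 4 \<le> card (allowed l f F) + card F"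
  unfolding allowed_def by (rule free_choices)

lemma allowed_D:
  assumes "x \<in> allowed l f F"
  shows "x \<in> L f" "e \<in> F \<Longrightarrow> good (l(f := x)) e"
  using assms by (auto simp: allowed_def)

lemma zero_allowed: "f \<in> E \<Longrightarrow> 0 \<notin> allowed l f F"
  using zero_L by (auto simp: allowed_def)

lemma star_edge_iff:
  assumes "star z a b c"
  shows "{z, w} \<in> E \<longleftrightarrow> w = a \<or> w = b \<or> w = c"
proof -
  have "{z, w} \<in> E \<longleftrightarrow> {z, w} \<in> inc z" by (simp add: inc_def)
  then show ?thesis using assms by (auto simp: star_def doubleton_eq_iff)
qed

lemma star_distinct:
  "star z a b c \<Longrightarrow> z \<noteq> a \<and> z \<noteq> b \<and> z \<noteq> c \<and> a \<noteq> b \<and> a \<noteq> c \<and> b \<noteq> c"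
  by (auto simp: star_def)

lemma star_edges: "star z a b c \<Longrightarrow> {z, a} \<in> E \<and> {z, b} \<in> E \<and> {z, c} \<in> E"
  by (simp add: star_edge_iff)

lemma star_inc: "star z a b c \<Longrightarrow> inc z = {{z, a}, {z, b}, {z, c}}"
  by (simp add: star_def)

lemma star_prod:
  "star z a b c \<Longrightarrow> prod l (inc z) = l {z, a} * l {z, b} * l {z, c}"
  by (auto simp: star_def doubleton_eq_iff mult.assoc)

lemma star_perm: "star z a b c \<Longrightarrow> star z a c b" "star z a b c \<Longrightarrow> star z b a c"
  by (auto simp: star_def)

lemma star_of_card:
  assumes "card (inc z) = 3"
  obtains a b c where "star z a b c"
proof -
  obtain e f g where efg: "inc z = {e, f, g}" "e \<noteq> f" "e \<noteq> g" "f \<noteq> g"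
    using assms by (auto simp: card_3_iff)
  have "\<exists>a. h = {z, a} \<and> a \<noteq> z" if "h \<in> inc z" for h
  proof -
    have "h \<in> E" "z \<in> h" using that by (auto simp: inc_def)
    then obtain u v where "h = {u, v}" "u \<noteq> v" using edge_obtain by metis
    then show ?thesis using \<open>z \<in> h\<close> by auto
  qed
  from this[of e] this[of f] this[of g]
  obtain a b c where "e = {z, a}" "a \<noteq> z" "f = {z, b}" "b \<noteq> z" "g = {z, c}" "c \<noteq> z"
    unfolding efg(1) by blast
  then have "star z a b c" using efg by (auto simp: star_def)
  then show thesis by (rule that)
qed

lemma star_with:
  assumes "card (inc a) = 3" "{a, z} \<in> E"
  obtains p q where "star a z p q"
proof -
  obtain x y w where s: "star a x y w" using star_of_card[OF assms(1)] by blast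
  then consider "z = x" | "z = y" | "z = w" using star_edge_iff[OF s] assms(2) by auto
  then show thesis
  proof cases
    case 1
    then show ?thesis using s by (intro that[of y w]) simp
  next
    case 2
    then show ?thesis using star_perm(2)[OF s] by (intro that[of x w]) simp
  next
    case 3
    then show ?thesis using star_perm(2)[OF star_perm(1)[OF s]] by (intro that[of x y]) simp
  qed
qed

lemma good_upd_far:
  assumes "e \<in> E" "f \<in> E" "f \<inter> e = {}"
  shows "good (l(f := y)) e \<longleftrightarrow> good l e"
  using assms edge_obtain[of f] by (intro good_upd_other) (auto simp: nb_def)

text \<open>An edge avoiding \<open>z\<close>, \<open>a\<close>, \<open>b\<close> and
  \<open>c\<close> is disjoint from the star, so its condition was due in the given stage and is not
  changed by the three updates.\<close>

lemma stage_star_final: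
  assumes s: "star z a b c" and st: "stage {{z, a}, {z, b}, {z, c}} l"
    and x: "x \<in> L {z, a}" "y \<in> L {z, b}" "w \<in> L {z, c}"
    and good: "\<And>e. \<lbrakk>e \<in> inc z \<union> inc a \<union> inc b \<union> inc c\<rbrakk> \<Longrightarrow>
      good (l({z, a} := x, {z, b} := y, {z, c} := w)) e"
  shows "stage {} (l({z, a} := x, {z, b} := y, {z, c} := w))"
  unfolding stage_def
proof (intro conjI ballI impI)
  show "labelling (l({z, a} := x, {z, b} := y, {z, c} := w))"
    using st x by (auto simp: stage_def intro!: labelling_upd)
  fix e assume e: "e \<in> E"
  show "good (l({z, a} := x, {z, b} := y, {z, c} := w)) e"
  proof (cases "e \<in> inc z \<union> inc a \<union> inc b \<union> inc c")
    case False
    then have far: "{z, a} \<inter> e = {}" "{z, b} \<inter> e = {}" "{z, c} \<inter> e = {}"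
      using e by (auto simp: inc_def)
    then have "nb e \<inter> {{z, a}, {z, b}, {z, c}} = {}" by (auto simp: nb_def)
    then have "good l e" using st e by (simp add: stage_def)
    then show ?thesis using far e star_edges[OF s] by (simp add: good_upd_far del: fun_upd_apply)
  qed (rule good)
qed

lemma star_stage_exists:
  assumes s: "star z a b c"
  shows "\<exists>l. stage {{z, a}, {z, b}, {z, c}} l"
proof (rule stage_exists)
  show "\<forall>g\<in>{{z, a}, {z, b}, {z, c}}. nb g \<inter> {{z, a}, {z, b}, {z, c}} \<noteq> {}"
    using star_edges[OF s] star_distinct[OF s] by (auto simp: nb_def doubleton_eq_iff)
qed (use star_edges[OF s] in auto)

section \<open>Stars with exactly one pair of adjacent leaves\<close>

text \<open>The candidate sets take care of the conditions at \<open>{a, p}\<close>,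
  \<open>{b, q}\<close>, \<open>{c, r}\<close> and \<open>{c, t}\<close>. The conditions at the star
  edges and at \<open>{a, b}\<close> are left to \<open>triple_with_ratio\<close>. Leaving
  \<open>{a, b}\<close> out of the candidate sets is what gives three candidates at
  \<open>{z, a}\<close> and at \<open>{z, b}\<close>.\<close>

lemma triangle_star:
  assumes s: "star z a b c" "star a z b p" "star b z a q" "star c z r t"
    and "{a, c} \<notin> E" "{b, c} \<notin> E"
  shows "\<exists>l. stage {} l"
proof -
  note d = star_distinct[OF s(1)] star_distinct[OF s(2)] star_distinct[OF s(3)] star_distinct[OF s(4)]
  note i = star_edges[OF s(1)] star_edges[OF s(2)] star_edges[OF s(3)] star_edges[OF s(4)]
  \<comment> \<open>By these inequalities each outer edge other than \<open>{a, b}\<close> meets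
    only one star edge, so its condition can be tested on that edge alone.\<close>
  have d': "a \<noteq> r" "a \<noteq> t" "b \<noteq> r" "b \<noteq> t" "p \<noteq> c" "q \<noteq> c"
    using i assms(5,6) by (auto simp: insert_commute)
  obtain l where st: "stage {{z, a}, {z, b}, {z, c}} l" using star_stage_exists[OF s(1)] by blast
  then have lab: "labelling l" by (simp add: stage_def)
  define M1 where "M1 = allowed l {z, a} {{a, p}}"
  define M2 where "M2 = allowed l {z, b} {{b, q}}"
  define M3 where "M3 = allowed l {z, c} {{c, r}, {c, t}}"
  have F: "{{a, p}} \<subseteq> nb {z, a}" "{{b, q}} \<subseteq> nb {z, b}" "{{c, r}, {c, t}} \<subseteq> nb {z, c}"
    using i d by (auto simp: nb_def doubleton_eq_iff)
  have "3 \<le> card M1" unfolding M1_def using card_allowed[OF lab _ F(1)] i(1) by simp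
  moreover have "3 \<le> card M2" unfolding M2_def using card_allowed[OF lab _ F(2)] i(1) by simp
  moreover have "4 \<le> card M3 + card {{c, r}, {c, t}}"
    unfolding M3_def by (rule card_allowed[OF lab _ F(3)]) (use i in simp)
  then have "2 \<le> card M3" using card_insert_le_m1[of 2 "{{c, t}}" "{c, r}"] by simp
  ultimately have card: "3 \<le> card M1" "3 \<le> card M2" "2 \<le> card M3" .
  have zero: "0 \<notin> M1" "0 \<notin> M2" "0 \<notin> M3" using i zero_allowed by (auto simp: M1_def M2_def M3_def)
  have nz: "l e \<noteq> 0" if "e \<in> E" for e using lab that zero_L by (metis labelling_def)
  obtain x y w where M: "x \<in> M1" "y \<in> M2" "w \<in> M3"
    and ne: "y * w \<noteq> l {a, b} * l {a, p}" "x * w \<noteq> l {a, b} * l {b, q}"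
      "x * y \<noteq> l {c, r} * l {c, t}" "x * l {a, p} \<noteq> y * l {b, q}"
    using triple_with_ratio[OF card zero, of "l {a, p}" "l {b, q}" "l {a, b}" "l {c, r} * l {c, t}"]
      nz i by blast
  let ?l = "l({z, a} := x, {z, b} := y, {z, c} := w)"
  have xyw: "x \<noteq> 0" "y \<noteq> 0" "w \<noteq> 0" using M zero by auto
  have "good ?l {z, a}" "good ?l {z, b}" "good ?l {z, c}" "good ?l {a, b}"
  proof -
    have l: "?l {z, a} = x" "?l {z, b} = y" "?l {z, c} = w" "?l {a, b} = l {a, b}"
      "?l {a, z} = x" "?l {b, z} = y" "?l {c, z} = w" "?l {b, a} = l {a, b}"
      "?l {a, p} = l {a, p}" "?l {b, q} = l {b, q}" "?l {c, r} = l {c, r}" "?l {c, t} = l {c, t}"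
      using d by (auto simp: doubleton_eq_iff insert_commute)
    have p: "prod ?l (inc z) = x * y * w" "prod ?l (inc a) = x * l {a, b} * l {a, p}"
      "prod ?l (inc b) = y * l {a, b} * l {b, q}" "prod ?l (inc c) = w * l {c, r} * l {c, t}"
      unfolding star_prod[OF s(1)] star_prod[OF s(2)] star_prod[OF s(3)] star_prod[OF s(4)] l by auto
    show "good ?l {z, a}" "good ?l {z, b}" "good ?l {z, c}" "good ?l {a, b}"
      unfolding good_iff p using ne xyw nz i by (auto simp: mult_ac)
  qed
  moreover have "good ?l {a, p}"
  proof -
    have "good (l({z, a} := x)) {a, p}" using M allowed_D by (auto simp: M1_def)
    then show ?thesis using i d d' by (subst good_upd_far, auto simp del: fun_upd_apply)+
  qed
  moreover have "good ?l {b, q}"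
  proof -
    have "good (l({z, b} := y)) {b, q}" using M allowed_D by (auto simp: M2_def)
    moreover have "?l = l({z, b} := y, {z, a} := x, {z, c} := w)"
      using d by (auto simp: fun_upd_twist doubleton_eq_iff)
    ultimately show ?thesis using i d d' by (simp only:) (subst good_upd_far, auto simp del: fun_upd_apply)+
  qed
  moreover have "good ?l {c, r}" "good ?l {c, t}"
  proof -
    have "good (l({z, c} := w)) {c, r}" "good (l({z, c} := w)) {c, t}"
      using M allowed_D by (auto simp: M3_def)
    moreover have "?l = l({z, c} := w, {z, a} := x, {z, b} := y)"
      using d by (auto simp: fun_upd_twist doubleton_eq_iff)
    ultimately show "good ?l {c, r}" "good ?l {c, t}"
      using i d d' by (simp_all only:) (subst good_upd_far, auto simp del: fun_upd_apply)+
  qed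
  ultimately have "good ?l e" if "e \<in> inc z \<union> inc a \<union> inc b \<union> inc c" for e
    using that unfolding star_inc[OF s(1)] star_inc[OF s(2)] star_inc[OF s(3)] star_inc[OF s(4)]
    by (auto simp: insert_commute simp del: fun_upd_apply)
  then have "stage {} ?l"
    using stage_star_final[OF s(1) st, of x y w] M allowed_D(1) unfolding M1_def M2_def M3_def by blast
  then show ?thesis by blast
qed

section \<open>Stars with pairwise nonadjacent leaves\<close>

text \<open>Each outer edge meets a single star edge, so the candidate sets settle all outer
  conditions independently and keep at least two labels each. If no choice from them works, the
  three star conditions block every triple and \<open>triple_blocked\<close> applies; the constant
  \<open>l {b, r} * l {b, u}\<close> comes from the condition at \<open>{z, b}\<close>.\<close>

lemma independent_star_blocked:
  assumes s: "star z a b c" "star a z p q" "star b z r u" "star c z t w"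
    and indep: "{a, b} \<notin> E" "{a, c} \<notin> E" "{b, c} \<notin> E"
    and st: "stage {{z, a}, {z, b}, {z, c}} l" and none: "\<nexists>l. stage {} l"
  defines "M1 \<equiv> allowed l {z, a} {{a, p}, {a, q}}"
    and "M3 \<equiv> allowed l {z, c} {{c, t}, {c, w}}"
  shows "M1 = (\<lambda>v. l {b, r} * l {b, u} / v) ` M3" and "card M1 = 2"
proof -
  note d = star_distinct[OF s(1)] star_distinct[OF s(2)] star_distinct[OF s(3)] star_distinct[OF s(4)]
  note i = star_edges[OF s(1)] star_edges[OF s(2)] star_edges[OF s(3)] star_edges[OF s(4)]
  have d': "a \<noteq> r" "a \<noteq> u" "a \<noteq> t" "a \<noteq> w" "b \<noteq> p" "b \<noteq> q" "b \<noteq> t" "b \<noteq> w"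
    "c \<noteq> p" "c \<noteq> q" "c \<noteq> r" "c \<noteq> u"
    using i indep by (auto simp: insert_commute)
  have lab: "labelling l" using st by (simp add: stage_def)
  define M2 where "M2 = allowed l {z, b} {{b, r}, {b, u}}"
  have F: "{{a, p}, {a, q}} \<subseteq> nb {z, a}" "{{b, r}, {b, u}} \<subseteq> nb {z, b}"
    "{{c, t}, {c, w}} \<subseteq> nb {z, c}"
    using i d by (auto simp: nb_def doubleton_eq_iff)
  have "4 \<le> card M1 + card {{a, p}, {a, q}}"
    unfolding M1_def by (rule card_allowed[OF lab _ F(1)]) (use i in simp)
  moreover have "4 \<le> card M2 + card {{b, r}, {b, u}}"
    unfolding M2_def by (rule card_allowed[OF lab _ F(2)]) (use i in simp)
  moreover have "4 \<le> card M3 + card {{c, t}, {c, w}}"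
    unfolding M3_def by (rule card_allowed[OF lab _ F(3)]) (use i in simp)
  moreover have "card {e, f} \<le> 2" for e f :: "'a set" by (simp add: card_insert_if)
  note this[of "{a, p}" "{a, q}"] this[of "{b, r}" "{b, u}"] this[of "{c, t}" "{c, w}"]
  ultimately have card: "2 \<le> card M1" "2 \<le> card M2" "2 \<le> card M3" by linarith+
  have zero: "0 \<notin> M1" "0 \<notin> M2" "0 \<notin> M3" using i zero_allowed by (auto simp: M1_def M2_def M3_def)
  have nz: "l e \<noteq> 0" if "e \<in> E" for e using lab that zero_L by (metis labelling_def)
  have blocked: "\<forall>x\<in>M1. \<forall>y\<in>M2. \<forall>v\<in>M3.
    y * v = l {a, p} * l {a, q} \<or> x * v = l {b, r} * l {b, u} \<or> x * y = l {c, t} * l {c, w}"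
  proof (intro ballI, rule ccontr)
    fix x y v assume M: "x \<in> M1" "y \<in> M2" "v \<in> M3"
      and "\<not> (y * v = l {a, p} * l {a, q} \<or> x * v = l {b, r} * l {b, u} \<or> x * y = l {c, t} * l {c, w})"
    then have ne: "y * v \<noteq> l {a, p} * l {a, q}" "x * v \<noteq> l {b, r} * l {b, u}"
      "x * y \<noteq> l {c, t} * l {c, w}" by auto
    let ?l = "l({z, a} := x, {z, b} := y, {z, c} := v)"
    have xyv: "x \<noteq> 0" "y \<noteq> 0" "v \<noteq> 0" using M zero by auto
    have "good ?l {z, a}" "good ?l {z, b}" "good ?l {z, c}"
    proof -
      have l: "?l {z, a} = x" "?l {z, b} = y" "?l {z, c} = v"
        "?l {a, z} = x" "?l {b, z} = y" "?l {c, z} = v" "?l {a, p} = l {a, p}" "?l {a, q} = l {a, q}"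
        "?l {b, r} = l {b, r}" "?l {b, u} = l {b, u}" "?l {c, t} = l {c, t}" "?l {c, w} = l {c, w}"
        using d by (auto simp: doubleton_eq_iff insert_commute)
      have p: "prod ?l (inc z) = x * y * v" "prod ?l (inc a) = x * l {a, p} * l {a, q}"
        "prod ?l (inc b) = y * l {b, r} * l {b, u}" "prod ?l (inc c) = v * l {c, t} * l {c, w}"
        unfolding star_prod[OF s(1)] star_prod[OF s(2)] star_prod[OF s(3)] star_prod[OF s(4)] l by auto
      show "good ?l {z, a}" "good ?l {z, b}" "good ?l {z, c}"
        unfolding good_iff p using ne xyv by (auto simp: mult_ac)
    qed
    moreover have "good ?l {a, p}" "good ?l {a, q}"
    proof -
      have "good (l({z, a} := x)) {a, p}" "good (l({z, a} := x)) {a, q}"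
        using M allowed_D by (auto simp: M1_def)
      then show "good ?l {a, p}" "good ?l {a, q}"
        using i d d' by (subst good_upd_far, auto simp del: fun_upd_apply)+
    qed
    moreover have "good ?l {b, r}" "good ?l {b, u}"
    proof -
      have "good (l({z, b} := y)) {b, r}" "good (l({z, b} := y)) {b, u}"
        using M allowed_D by (auto simp: M2_def)
      moreover have "?l = l({z, b} := y, {z, a} := x, {z, c} := v)"
        using d by (auto simp: fun_upd_twist doubleton_eq_iff)
      ultimately show "good ?l {b, r}" "good ?l {b, u}"
        using i d d' by (simp_all only:) (subst good_upd_far, auto simp del: fun_upd_apply)+
    qed
    moreover have "good ?l {c, t}" "good ?l {c, w}"
    proof -
      have "good (l({z, c} := v)) {c, t}" "good (l({z, c} := v)) {c, w}"
        using M allowed_D by (auto simp: M3_def)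
      moreover have "?l = l({z, c} := v, {z, a} := x, {z, b} := y)"
        using d by (auto simp: fun_upd_twist doubleton_eq_iff)
      ultimately show "good ?l {c, t}" "good ?l {c, w}"
        using i d d' by (simp_all only:) (subst good_upd_far, auto simp del: fun_upd_apply)+
    qed
    ultimately have "good ?l e" if "e \<in> inc z \<union> inc a \<union> inc b \<union> inc c" for e
      using that unfolding star_inc[OF s(1)] star_inc[OF s(2)] star_inc[OF s(3)] star_inc[OF s(4)]
      by (auto simp: insert_commute simp del: fun_upd_apply)
    then have "stage {} ?l"
      using stage_star_final[OF s(1) st, of x y v] M allowed_D(1) unfolding M1_def M2_def M3_def by blast
    then show False using none by blast
  qed
  have "l {b, r} * l {b, u} \<noteq> 0" using nz i by simp
  then show "M1 = (\<lambda>v. l {b, r} * l {b, u} / v) ` M3" "card M1 = 2"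
    using triple_blocked[OF card zero _ blocked] by blast+
qed

text \<open>If every labelling of the three edges at \<open>z\<close> fails, relabel \<open>{a, p}\<close>. Each admissible label \<open>y\<close> removes
  its own value \<open>\<kappa> / y\<close> from a fixed set \<open>K\<close> of candidates for \<open>{z, a}\<close>, and exactly two candidates must remain.
  If \<open>p\<close> and \<open>c\<close> are not adjacent, the remaining pair is determined by \<open>{z, c}\<close> and hence independent of \<open>y\<close>.\<close>
lemma independent_star:
  assumes s: "star z a b c" "star a z p q" "star b z r u" "star c z t w"
    and indep: "{a, b} \<notin> E" "{a, c} \<notin> E" "{b, c} \<notin> E"
    and pc: "{p, c} \<notin> E \<or> star p a b c"
  shows "\<exists>l. stage {} l"
proof (rule ccontr)
  assume none: "\<nexists>l. stage {} l"
  note d = star_distinct[OF s(1)] star_distinct[OF s(2)] star_distinct[OF s(3)] star_distinct[OF s(4)]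
  note i = star_edges[OF s(1)] star_edges[OF s(2)] star_edges[OF s(3)] star_edges[OF s(4)]
  have d': "a \<noteq> r" "a \<noteq> u" "a \<noteq> t" "a \<noteq> w" "b \<noteq> p" "b \<noteq> q" "b \<noteq> t" "b \<noteq> w"
    "c \<noteq> p" "c \<noteq> q" "c \<noteq> r" "c \<noteq> u"
    using i indep by (auto simp: insert_commute)
  let ?S = "{{z, a}, {z, b}, {z, c}}"
  have apE: "{a, p} \<in> E" and aqE: "{a, q} \<in> E" and zaE: "{z, a} \<in> E" using i by auto
  have ap: "{a, p} \<noteq> {z, a}" "{a, p} \<noteq> {z, b}" "{a, p} \<noteq> {z, c}" "{a, q} \<noteq> {a, p}" "{a, q} \<noteq> {z, a}"
    using d by (auto simp: doubleton_eq_iff)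
  have adj: "{z, b} \<in> nb {z, a}" "{z, a} \<in> nb {z, b}" "{z, a} \<in> nb {z, c}"
    "{z, a} \<in> nb {a, p}" "{z, a} \<in> nb {a, q}" "{a, q} \<in> nb {a, p}" "{a, p} \<in> nb {z, a}"
    using i d ap by (auto simp: nb_def doubleton_eq_iff)
  have "\<exists>l. stage (insert {a, p} ?S) l"
  proof (rule stage_exists)
    show "\<forall>g\<in>insert {a, p} ?S. nb g \<inter> insert {a, p} ?S \<noteq> {}" using adj by blast
  qed (use i in auto)
  then obtain l where l: "stage (insert {a, p} ?S) l" by blast
  then have lab: "labelling l" by (simp add: stage_def)
  have nz: "l e \<noteq> 0" if "e \<in> E" for e using lab that zero_L by (metis labelling_def)
  define Y where "Y = {y \<in> L {a, p}. stage ?S (l({a, p} := y))}"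
  define D where "D = {e \<in> nb {a, p}. nb e \<inter> ?S = {}}"
  have Y_D: "4 \<le> card Y + card D" unfolding Y_def D_def by (rule stage_step[OF l apE])
  have Y0: "0 \<notin> Y" using zero_L[OF apE] by (auto simp: Y_def)
  \<comment> \<open>\<open>K\<close> serves for every label of \<open>{a, p}\<close>, since that
    label cancels in the condition at \<open>{a, p}\<close>.\<close>
  define K where "K = allowed l {z, a} {{a, p}}"
  have "{{a, p}} \<subseteq> nb {z, a}" using adj by simp
  then have K: "3 \<le> card K" using card_allowed[OF lab zaE, of "{{a, p}}"] by (simp add: K_def)
  have "prod l (inc q) \<noteq> 0" using labelling_nonzero[OF lab inc_subset] .
  \<comment> \<open>The condition at \<open>{a, q}\<close> compares \<open>x * y * l {a, q}\<close>
    with the product at \<open>q\<close>, which contains neither of the labels \<open>x\<close> and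
    \<open>y\<close> of \<open>{z, a}\<close> and \<open>{a, p}\<close>. It fails exactly when
    \<open>x * y = \<kappa>\<close>.\<close>
  define \<kappa> where "\<kappa> = prod l (inc q) / l {a, q}"
  have \<kappa>: "\<kappa> \<noteq> 0" using \<open>prod l (inc q) \<noteq> 0\<close> nz[OF aqE] by (simp add: \<kappa>_def)
  define M1 where "M1 y = allowed (l({a, p} := y)) {z, a} {{a, p}, {a, q}}" for y
  define M3 where "M3 y = allowed (l({a, p} := y)) {z, c} {{c, t}, {c, w}}" for y
  have M1: "M1 y = {x \<in> K. x * y \<noteq> \<kappa>}" if y: "y \<in> Y" for y
  proof -
    have "good (l({a, p} := y, {z, a} := x)) {a, p} \<longleftrightarrow> good (l({z, a} := x)) {a, p}" for x
    proof -
      have "y \<noteq> 0" using y Y0 by auto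
      moreover have "(l({z, a} := x)) {a, p} \<noteq> 0" using ap nz[OF apE] by simp
      ultimately show ?thesis
        using good_upd_self[OF apE, of "l({z, a} := x)" y] fun_upd_twist[OF ap(1), of l y x] by simp
    qed
    moreover have "good (l({a, p} := y, {z, a} := x)) {a, q} \<longleftrightarrow> x * y \<noteq> \<kappa>" for x
    proof -
      have "prod (l({a, p} := y, {z, a} := x)) (inc a) = x * y * l {a, q}"
        unfolding star_prod[OF s(2)] using ap d by (auto simp: insert_commute)
      moreover have "prod (l({a, p} := y, {z, a} := x)) (inc q) = prod l (inc q)"
      proof -
        have "{a, p} \<notin> inc q" "{z, a} \<notin> inc q" using d by (auto simp: inc_def)
        then show ?thesis by (simp add: prod_upd_other del: fun_upd_apply)
      qed
      ultimately show ?thesis using nz[OF aqE] unfolding good_iff by (simp add: \<kappa>_def eq_divide_eq)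
    qed
    ultimately show ?thesis by (auto simp: M1_def K_def allowed_def)
  qed
  have blocked: "M1 y = (\<lambda>v. l {b, r} * l {b, u} / v) ` M3 y" "card (M1 y) = 2" if y: "y \<in> Y" for y
  proof -
    have st: "stage ?S (l({a, p} := y))" using y by (simp add: Y_def)
    have "{b, r} \<noteq> {a, p}" "{b, u} \<noteq> {a, p}" using d d' by (auto simp: doubleton_eq_iff)
    then show "M1 y = (\<lambda>v. l {b, r} * l {b, u} / v) ` M3 y" "card (M1 y) = 2"
      using independent_star_blocked[OF s indep st none] by (simp_all add: M1_def M3_def)
  qed
  have two: "\<forall>y\<in>Y. card {x \<in> K. x * y \<noteq> \<kappa>} = 2" using blocked(2) M1 by simp
  have inc_a: "inc a = {{z, a}, {a, p}, {a, q}}" using star_inc[OF s(2)] by (simp add: insert_commute)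
  have meets: "nb {z, a} \<inter> ?S \<noteq> {}" "nb {a, q} \<inter> ?S \<noteq> {}"
    using adj by auto
  from pc show False
  proof
    assume pc: "{p, c} \<notin> E"
    \<comment> \<open>Both removed edges touch the star, so their conditions are not yet due. This
      leaves at most two due conditions, hence two labels \<open>y\<close> to compare.\<close>
    have "D \<subseteq> nb {a, p} - {{z, a}, {a, q}}" using meets by (auto simp: D_def)
    then have "card D \<le> card (nb {a, p} - {{z, a}, {a, q}})" by (intro card_mono) auto
    also have "\<dots> = card (nb {a, p}) - card {{z, a}, {a, q}}" using adj by (intro card_Diff_subset) auto
    also have "card {{z, a}, {a, q}} = 2" using ap(5) by auto
    finally have "card D \<le> card (nb {a, p}) - 2" .
    then have "2 \<le> card Y" using Y_D card_nb_le_4[OF apE] by linarith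
    then obtain y where y: "y \<in> Y" by fastforce
    obtain y' where y': "y' \<in> Y" "y' \<noteq> y" using exists_avoiding[of "{y}" Y] \<open>2 \<le> card Y\<close> by auto
    have "good (l({a, p} := y, {z, c} := x)) e \<longleftrightarrow> good (l({z, c} := x)) e"
      if e: "e = {c, t} \<or> e = {c, w}" for x y e
    proof -
      have "{a, p} \<inter> e = {}" using e d d' pc i by (auto simp: insert_commute)
      moreover have "e \<in> E" using e i by auto
      ultimately show ?thesis
        using good_upd_far[OF _ apE, of e "l({z, c} := x)" y] fun_upd_twist[OF ap(3), of l y x] by simp
    qed
    then have "M3 y = M3 y'" by (auto simp: M3_def allowed_def)
    then have "M1 y = M1 y'" using blocked(1) y y'(1) by simp
    then have "y = y'" using varying_exclusion(2)[OF K Y0 \<kappa> two y y'(1)] M1 y y'(1) by simp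
    then show False using y'(2) by simp
  next
    assume p: "star p a b c"
    \<comment> \<open>Here every edge adjacent to \<open>{a, p}\<close> also touches the star, so no
      condition is due and all four labels of \<open>{a, p}\<close> are admissible, one more than
      \<open>varying_exclusion\<close> permits.\<close>
    have "nb e \<inter> ?S \<noteq> {}" if "e \<in> nb {a, p}" for e
    proof -
      have "e \<in> {{z, a}, {a, q}, {p, b}, {p, c}}"
        using that unfolding nb_eq[OF apE] inc_a star_inc[OF p] by (auto simp: insert_commute)
      moreover have "{z, b} \<in> nb {p, b}" "{z, c} \<in> nb {p, c}"
        using i d star_distinct[OF p] by (auto simp: nb_def doubleton_eq_iff)
      ultimately show ?thesis using meets by auto
    qed
    then have "D = {}" by (auto simp: D_def)
    then have "4 \<le> card Y" using Y_D by simp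
    then show False using varying_exclusion(1)[OF K Y0 \<kappa> two] by simp
  qed
qed

section \<open>The complete graph on four vertices\<close>

text \<open>All six edges are labelled at once. Opposite edges are paired (\<open>x\<close> with
  \<open>x'\<close>, and so on); the condition at an edge then involves only the other two pairs,
  and the six conditions are exactly the inequalities of \<open>K4_choice\<close>.\<close>

lemma K4:
  assumes s: "star z a b c" "star a z b c" "star b z a c" "star c z a b"
  shows "\<exists>l. stage {} l"
proof -
  note d = star_distinct[OF s(1)]
  note i = star_edges[OF s(1)] star_edges[OF s(2)] star_edges[OF s(3)]
  note comm = insert_commute[of a z "{}"] insert_commute[of b z "{}"] insert_commute[of c z "{}"]
    insert_commute[of b a "{}"] insert_commute[of c a "{}"] insert_commute[of c b "{}"]
  define U where "U = {{z, a}, {z, b}, {z, c}, {a, b}, {a, c}, {b, c}}"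
  have "inc z \<subseteq> U" "inc a \<subseteq> U" "inc b \<subseteq> U" "inc c \<subseteq> U"
    unfolding star_inc[OF s(1)] star_inc[OF s(2)] star_inc[OF s(3)] star_inc[OF s(4)] comm
    by (simp_all add: U_def)
  then have inc: "inc v \<subseteq> U" if "v \<in> {z, a, b, c}" for v
    using that by blast
  \<comment> \<open>The four vertices already have all their edges in \<open>U\<close>, so
    connectedness leaves no further edge.\<close>
  have E: "E = U"
  proof (rule ccontr)
    assume "E \<noteq> U"
    moreover have "U \<subseteq> E" "U \<noteq> {}" using i by (simp_all add: U_def)
    ultimately obtain f g where fg: "f \<in> E - U" "g \<in> U" "f \<inter> g \<noteq> {}"
      using connected[of U] by metis
    then obtain v where v: "v \<in> f" "v \<in> g" by blast
    have "v \<in> {z, a, b, c}" using v(2) fg(2) unfolding U_def by blast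
    then have "inc v \<subseteq> U" by (rule inc)
    moreover have "f \<in> inc v" using fg(1) v(1) by (simp add: inc_def)
    ultimately show False using fg(1) by blast
  qed
  obtain x x' y y' w w' where in_L: "x \<in> L {z, a}" "x' \<in> L {b, c}" "y \<in> L {z, b}" "y' \<in> L {a, c}"
      "w \<in> L {z, c}" "w' \<in> L {a, b}"
    and ne: "x * y \<noteq> x' * y'" "x * y' \<noteq> x' * y" "x * w \<noteq> x' * w'" "x * w' \<noteq> x' * w"
      "y * w \<noteq> y' * w'" "y * w' \<noteq> y' * w"
    by (rule K4_choice[of "L {z, a}" "L {b, c}" "L {z, b}" "L {a, c}" "L {z, c}" "L {a, b}"])
      (use i card_L zero_L in auto)
  define l where "l = (\<lambda>_. 0)({z, a} := x, {b, c} := x', {z, b} := y, {a, c} := y', {z, c} := w, {a, b} := w')"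
  have l: "l {z, a} = x" "l {b, c} = x'" "l {z, b} = y" "l {a, c} = y'" "l {z, c} = w" "l {a, b} = w'"
    using d by (auto simp: l_def doubleton_eq_iff)
  have nz: "x \<noteq> 0" "x' \<noteq> 0" "y \<noteq> 0" "y' \<noteq> 0" "w \<noteq> 0" "w' \<noteq> 0"
    using in_L zero_L i by metis+
  have p: "prod l (inc z) = x * y * w" "prod l (inc a) = x * w' * y'"
    "prod l (inc b) = y * w' * x'" "prod l (inc c) = w * y' * x'"
    using star_prod[OF s(1), of l] star_prod[OF s(2), of l] star_prod[OF s(3), of l] star_prod[OF s(4), of l]
    unfolding comm l by simp_all
  have "good l {z, a}" "good l {b, c}" "good l {z, b}" "good l {a, c}" "good l {z, c}" "good l {a, b}"
    unfolding good_iff p using ne nz by (auto simp: mult_ac)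
  then have "\<forall>e\<in>E. good l e" unfolding E U_def by simp
  moreover have "\<forall>e\<in>U. l e \<in> L e" unfolding U_def using in_L l by simp
  then have "labelling l" using E by (metis labelling_def)
  ultimately show ?thesis by (auto simp: stage_def)
qed

lemma star_with2:
  assumes "star a z p q" "{a, b} \<in> E" "b \<noteq> z"
  obtains r where "star a z b r"
proof -
  have "b = p \<or> b = q" using assms star_edge_iff by blast
  then show thesis using that assms(1) star_perm(1) by blast
qed

section \<open>Cubic components\<close>

text \<open>Case distinction on the number of adjacent pairs among the neighbours \<open>a\<close>,
  \<open>b\<close>, \<open>c\<close> of one vertex: \<open>none\<close> and \<open>one\<close> treat
  zero and one pair, \<open>two\<close> treats two or three.\<close>

lemma cubic:
  assumes card3: "\<And>e v. \<lbrakk>e \<in> E; v \<in> e\<rbrakk> \<Longrightarrow> card (inc v) = 3" and e: "e \<in> E"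
  shows "\<exists>l. stage {} l"
proof -
  have star_at: "\<exists>p q. star v u p q" if "{v, u} \<in> E" for u v
    using star_with[OF card3[OF that] that] by blast
  have one: "\<exists>l. stage {} l"
    if s: "star z a b c" and ab: "{a, b} \<in> E" and n: "{a, c} \<notin> E" "{b, c} \<notin> E" for z a b c
  proof -
    have az: "{a, z} \<in> E" "{b, z} \<in> E" "{c, z} \<in> E" "{b, a} \<in> E"
      using star_edges[OF s] ab by (simp_all add: insert_commute)
    obtain p where "star a z b p"
      using star_at[OF az(1)] star_with2 ab star_distinct[OF s] by metis
    moreover obtain q where "star b z a q"
      using star_at[OF az(2)] star_with2 az(4) star_distinct[OF s] by metis
    moreover obtain r t where "star c z r t" using star_at[OF az(3)] by blast
    ultimately show ?thesis using triangle_star[OF s _ _ _ n] by blast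
  qed
  have two: "\<exists>l. stage {} l" if s: "star z a b c" and ab: "{a, b} \<in> E" and ac: "{a, c} \<in> E" for z a b c
  proof -
    note d = star_distinct[OF s]
    have az: "{a, z} \<in> E" "{b, z} \<in> E" "{c, z} \<in> E" "{b, a} \<in> E" "{c, a} \<in> E"
      using star_edges[OF s] ab ac by (simp_all add: insert_commute)
    obtain p where p: "star a z b p" using star_at[OF az(1)] star_with2 ab d by metis
    then have "p = c" using star_edge_iff[OF p, of c] ac d by auto
    then have sa: "star a z b c" using p by simp
    obtain q where q: "star b z a q" using star_at[OF az(2)] star_with2 az(4) d by metis
    note dq = star_distinct[OF q]
    show ?thesis
    proof (cases "{b, c} \<in> E")
      case True
      then have "q = c" using star_edge_iff[OF q, of c] d by auto
      obtain r where r: "star c z a r" using star_at[OF az(3)] star_with2 az(5) d by metis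
      then have "r = b" using star_edge_iff[OF r, of b] True d by (auto simp: insert_commute)
      then show ?thesis using K4[OF s sa] q r \<open>q = c\<close> by simp
    next
      case False
      then have "q \<noteq> c" using star_edges[OF q] by auto
      \<comment> \<open>All neighbours of \<open>z\<close> and of \<open>a\<close> are known and
        \<open>q\<close> is not among them. The star at \<open>b\<close> therefore has just the one
        adjacent pair \<open>z\<close>, \<open>a\<close> among its leaves, so \<open>one\<close>
        applies at \<open>b\<close> instead of \<open>z\<close>.\<close>
      then have "{z, q} \<notin> E" "{a, q} \<notin> E"
        using star_edge_iff[OF s, of q] star_edge_iff[OF sa, of q] dq by auto
      moreover have "{z, a} \<in> E" using star_edges[OF s] by simp
      ultimately show ?thesis using one[OF q] by blast
    qed
  qed
  have none: "\<exists>l. stage {} l"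
    if s: "star z a b c" and n: "{a, b} \<notin> E" "{a, c} \<notin> E" "{b, c} \<notin> E" for z a b c
  proof -
    note d = star_distinct[OF s]
    have az: "{a, z} \<in> E" "{b, z} \<in> E" "{c, z} \<in> E"
      using star_edges[OF s] by (simp_all add: insert_commute)
    obtain p q where sa: "star a z p q" using star_at[OF az(1)] by blast
    obtain r u where sb: "star b z r u" using star_at[OF az(2)] by blast
    obtain t w where sc: "star c z t w" using star_at[OF az(3)] by blast
    \<comment> \<open>If \<open>p\<close> misses \<open>b\<close> instead of \<open>c\<close>,
      exchanging \<open>b\<close> and \<open>c\<close> reduces to the first case. If
      \<open>p\<close> meets both, degree three leaves it exactly the neighbours \<open>a\<close>,
      \<open>b\<close>, \<open>c\<close>.\<close>
    consider "{p, c} \<notin> E" | "{p, b} \<notin> E" | "{p, c} \<in> E" "{p, b} \<in> E" by blast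
    then show ?thesis
    proof cases
      case 1
      then show ?thesis using independent_star[OF s sa sb sc n] by blast
    next
      case 2
      then show ?thesis
        using independent_star[OF star_perm(1)[OF s] sa sc sb n(2,1)] n(3) by (auto simp: insert_commute)
    next
      case 3
      have "{p, a} \<in> E" using star_edges[OF sa] by (simp add: insert_commute)
      then obtain x where x: "star p a b x" using star_at star_with2 3(2) d by metis
      then have "x = c" using star_edge_iff[OF x, of c] 3(1) d by auto
      then show ?thesis using independent_star[OF s sa sb sc n] x by blast
    qed
  qed
  obtain z where "z \<in> e" using edge_obtain[OF e] by blast
  then obtain a b c where s: "star z a b c" using star_of_card card3 e by metis
  have sb: "star z b a c" and sc: "star z c a b" and sac: "star z a c b" and sbc: "star z b c a"
    using s by (auto simp: star_def)
  show ?thesis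
    using one[OF s] one[OF sac] one[OF sbc] two[OF s] two[OF sb] two[OF sc] none[OF s]
    by (metis insert_commute)
qed

lemma stage_empty_exists: "\<exists>l. stage {} l"
proof (cases "\<exists>r\<in>E. card (nb r) \<le> 3")
  case True
  then show ?thesis using noncubic by blast
next
  case False
  show ?thesis
  proof (cases "E = {}")
    case True
    have "stage {} l" for l unfolding stage_def labelling_def using True by blast
    then show ?thesis by blast
  next
    case nonempty: False
    have "card (inc v) = 3" if e: "e \<in> E" "v \<in> e" for e v
    proof -
      obtain u where u: "e = {v, u}" using edge_obtain[OF e(1)] e(2) by blast
      \<comment> \<open>Four adjacent edges are possible only if both ends have degree
        three.\<close>
      have "3 < card (nb e)" using False e(1) by auto
      then show ?thesis
        using card_nb_le[of v u] card_inc_le[of u] card_inc_le[of v] e(1) unfolding u by linarith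
    qed
    then show ?thesis using cubic nonempty by blast
  qed
qed

lemma labelling_exists:
  "\<exists>l. \<forall>e\<in>E. l e \<in> L e \<and> (\<forall>u v. e = {u, v} \<longrightarrow> prod l {f \<in> E. u \<in> f} \<noteq> prod l {f \<in> E. v \<in> f})"
  using stage_empty_exists unfolding stage_def labelling_def good_def inc_def by (auto simp only: Int_empty_right)

end

section \<open>From components to the whole graph\<close>

lemma reachable_from_refl: "v \<in> reachable_from G v"
  by (simp add: reachable_from_def)

lemma reachable_from_step:
  "\<lbrakk>x \<in> reachable_from G v; {x, y} \<in> edges G\<rbrakk> \<Longrightarrow> y \<in> reachable_from G v"
  by (auto simp: reachable_from_def intro: rtrancl_into_rtrancl)

lemma reachable_from_eq:
  assumes "u \<in> reachable_from G v"
  shows "reachable_from G u = reachable_from G v"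
proof -
  let ?R = "{(x, y). {x, y} \<in> edges G}"
  have "sym (?R\<^sup>*)" by (intro sym_rtrancl) (auto simp: sym_def insert_commute)
  then have "(v, u) \<in> ?R\<^sup>*" "(u, v) \<in> ?R\<^sup>*" using assms by (auto simp: reachable_from_def dest: symD)
  then show ?thesis by (auto simp: reachable_from_def)
qed

text \<open>From the ends of an edge that meets no other edge nothing else can be reached, so the
  edge would span a component isomorphic to \<open>K2\<close>.\<close>

lemma nice_edge_has_neighbour:
  assumes G: "finite_simple_graph G" "nice G" and e: "e \<in> edges G"
  shows "\<exists>f\<in>edges G. f \<noteq> e \<and> f \<inter> e \<noteq> {}"
proof (rule ccontr)
  assume isolated: "\<not> ?thesis"
  obtain u v where uv: "e = {u, v}" "u \<noteq> v" and vert: "u \<in> verts G"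
    using G(1) e by (force simp: finite_simple_graph_def card_2_iff)
  have "w \<in> {u, v}" if "w \<in> reachable_from G u" for w
    using that unfolding reachable_from_def mem_Collect_eq
  proof (induction rule: rtrancl_induct)
    case (step x y)
    then have "{x, y} = {u, v}" using isolated uv by auto
    then show ?case by auto
  qed simp
  moreover have "v \<in> reachable_from G u"
    using reachable_from_step[OF reachable_from_refl] e uv(1) by metis
  ultimately have reach: "reachable_from G u = {u, v}" using reachable_from_refl by fast
  let ?H = "induced_subgraph G {u, v}"
  have "?H \<in> connected_components G"
    using vert reach unfolding connected_components_def by (metis imageI)
  moreover have "graph_isomorphic ?H K2"
    unfolding graph_isomorphic_def
  proof (intro exI[of _ "\<lambda>x. if x = u then 0 else 1"] conjI ballI)
    show "bij_betw (\<lambda>x. if x = u then 0 else 1) (verts ?H) (verts K2)"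
      using uv(2) by (auto simp: bij_betw_def inj_on_def induced_subgraph_def K2_def)
    have no_loop: "{x, x} \<notin> edges G" for x using G(1) by (force simp: finite_simple_graph_def)
    fix x y assume "x \<in> verts ?H" "y \<in> verts ?H"
    then show "{x, y} \<in> edges ?H \<longleftrightarrow>
        {if x = u then 0 else 1, if y = u then 0 else 1} \<in> edges K2"
      using e uv no_loop[of u] no_loop[of v]
      by (auto simp: induced_subgraph_def K2_def insert_commute doubleton_eq_iff)
  qed
  ultimately show False using G(2) unfolding nice_def by blast
qed

lemma component_nice_subcubic:
  fixes G :: "'a graph"
  assumes G: "finite_simple_graph G" "nice G" "subcubic G"
    and L: "list_assignment G 4 L" "\<forall>e\<in>edges G. 0 \<notin> L e"
  shows "nice_subcubic {e \<in> edges G. e \<subseteq> reachable_from G v} L"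
    (is "nice_subcubic ?E L")
proof
  have fin: "finite (edges G)"
    using G(1) finite_subset[of "edges G" "Pow (verts G)"] by (auto simp: finite_simple_graph_def)
  then show "finite ?E" by simp
  show "card e = 2" if "e \<in> ?E" for e using that G(1) by (auto simp: finite_simple_graph_def)
  show "finite (L e)" "card (L e) = 4" "0 \<notin> L e" if "e \<in> ?E" for e
    using that L by (auto simp: list_assignment_def)
  show "card {e \<in> ?E. w \<in> e} \<le> 3" for w
  proof (cases "w \<in> verts G")
    case True
    have "finite (insert 0 (degree G ` verts G))" using G(1) by (simp add: finite_simple_graph_def)
    then have "degree G w \<le> max_degree G"
      unfolding max_degree_def using True by (intro Max_ge) auto
    then have deg: "card (neighbours G w) \<le> 3" using G(3) by (simp add: subcubic_def degree_def)
    have "neighbours G w \<subseteq> verts G" using G(1) by (auto simp: neighbours_def finite_simple_graph_def)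
    then have finN: "finite (neighbours G w)"
      using G(1) finite_subset by (auto simp: finite_simple_graph_def)
    have "{e \<in> ?E. w \<in> e} \<subseteq> (\<lambda>x. {w, x}) ` neighbours G w"
    proof
      fix e assume "e \<in> {e \<in> ?E. w \<in> e}"
      then have "e \<in> edges G" "w \<in> e" "card e = 2" using G(1) by (auto simp: finite_simple_graph_def)
      then obtain x where "e = {w, x}" by (auto simp: card_2_iff)
      then show "e \<in> (\<lambda>x. {w, x}) ` neighbours G w" using \<open>e \<in> edges G\<close> by (auto simp: neighbours_def)
    qed
    then show ?thesis using surj_card_le[OF finN] deg by (meson order_trans)
  next
    case False
    then have "{e \<in> ?E. w \<in> e} = {}" using G(1) by (auto simp: finite_simple_graph_def)
    then show ?thesis by (simp only: card.empty)
  qed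
  have meets: "f \<in> ?E" if fg: "g \<in> ?E" "f \<in> edges G" "f \<inter> g \<noteq> {}" for f g
  proof -
    obtain x where x: "x \<in> f" "x \<in> reachable_from G v" using fg by auto
    have "card f = 2" using that G(1) by (auto simp: finite_simple_graph_def)
    then obtain y where "f = {x, y}" using x(1) by (auto simp: card_2_iff)
    then show ?thesis using that x reachable_from_step[OF x(2)] by auto
  qed
  show "\<exists>f\<in>?E. f \<noteq> e \<and> f \<inter> e \<noteq> {}" if "e \<in> ?E" for e
    using nice_edge_has_neighbour[OF G(1,2), of e] that meets by blast
  show "\<exists>f\<in>?E - U. \<exists>g\<in>U. f \<inter> g \<noteq> {}" if U: "U \<subseteq> ?E" "U \<noteq> {}" "U \<noteq> ?E" for U
  proof (rule ccontr)
    assume no: "\<not> ?thesis"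
    have closed: "f \<in> U" if "f \<in> ?E" "g \<in> U" "x \<in> f" "x \<in> g" for f g x
    proof (rule ccontr)
      assume "f \<notin> U"
      then have "f \<in> ?E - U" using that(1) by (rule DiffI[rotated])
      then show False using no that(2-4) by (metis disjoint_iff)
    qed
    have nonempty: "e \<noteq> {}" if "e \<in> ?E" for e using that G(1) by (force simp: finite_simple_graph_def)
    obtain g h where gh: "g \<in> U" "h \<in> ?E - U" using U by blast
    then obtain x y where xy: "x \<in> g" "y \<in> h" using nonempty[of g] nonempty[of h] U(1) by blast
    have "x \<in> reachable_from G v" "y \<in> reachable_from G v" using xy gh U(1) by auto
    then have "y \<in> reachable_from G x" using reachable_from_eq by metis
    \<comment> \<open>If no outside edge touches \<open>U\<close>, the vertices covered by
      \<open>U\<close> are closed under steps along edges. A walk from \<open>x\<close> then carries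
      the covering to \<open>y\<close>, which forces \<open>h\<close> into \<open>U\<close>.\<close>
    then have "y \<in> \<Union>U" unfolding reachable_from_def mem_Collect_eq
    proof (induction rule: rtrancl_induct)
      case base
      show ?case using xy gh by blast
    next
      case (step u w)
      then obtain g' where g': "g' \<in> U" "u \<in> g'" by blast
      then have "{u, w} \<in> ?E" using meets[of g' "{u, w}"] step(2) U(1) by auto
      then have "{u, w} \<in> U" using closed[of "{u, w}" g' u] g' by simp
      then show ?case by auto
    qed
    then obtain g' where "g' \<in> U" "y \<in> g'" by blast
    then show False using closed[of h g' y] gh xy by simp
  qed
qed

lemma vertex_product_eq:
  assumes "finite_simple_graph G"
  shows "vertex_product G l v = prod l {e \<in> edges G. v \<in> e}"
proof -
  have "{e \<in> edges G. v \<in> e} = (\<lambda>x. {v, x}) ` neighbours G v"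
  proof (intro equalityI subsetI)
    fix e assume "e \<in> {e \<in> edges G. v \<in> e}"
    then have e: "e \<in> edges G" "v \<in> e" "card e = 2" using assms by (auto simp: finite_simple_graph_def)
    then obtain x where "e = {v, x}" by (auto simp: card_2_iff)
    then show "e \<in> (\<lambda>x. {v, x}) ` neighbours G v" using e(1) by (auto simp: neighbours_def)
  qed (auto simp: neighbours_def)
  moreover have "inj_on (\<lambda>x. {v, x}) (neighbours G v)" by (auto simp: inj_on_def doubleton_eq_iff)
  ultimately show ?thesis by (simp add: prod.reindex vertex_product_def)
qed

lemma component_labelling:
  fixes G :: "'a graph"
  assumes G: "finite_simple_graph G" "nice G" "subcubic G"
    and L: "list_assignment G 4 L" "\<forall>e\<in>edges G. 0 \<notin> L e"
  shows "\<exists>l. \<forall>u v. {u, v} \<in> edges G \<longrightarrow> u \<in> reachable_from G w \<longrightarrow> v \<in> reachable_from G w \<longrightarrow>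
    l {u, v} \<in> L {u, v} \<and> prod l {e \<in> edges G. u \<in> e} \<noteq> prod l {e \<in> edges G. v \<in> e}"
proof -
  define E where "E = {e \<in> edges G. e \<subseteq> reachable_from G w}"
  have "nice_subcubic E L" unfolding E_def using component_nice_subcubic[OF G L] .
  then obtain l where l: "\<forall>e\<in>E. l e \<in> L e \<and>
      (\<forall>u v. e = {u, v} \<longrightarrow> prod l {f \<in> E. u \<in> f} \<noteq> prod l {f \<in> E. v \<in> f})"
    using nice_subcubic.labelling_exists by blast
  \<comment> \<open>A component contains every edge at each of its vertices, so vertex products
    taken in the component and in \<open>G\<close> agree.\<close>
  have inc: "{f \<in> E. u \<in> f} = {e \<in> edges G. u \<in> e}" if u: "u \<in> reachable_from G w" for u
  proof -
    have "e \<subseteq> reachable_from G w" if e: "e \<in> edges G" "u \<in> e" for e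
    proof -
      have "card e = 2" using e(1) G(1) by (auto simp: finite_simple_graph_def)
      then obtain v where "e = {u, v}" using e(2) by (auto simp: card_2_iff)
      then show ?thesis using u e(1) reachable_from_step by fastforce
    qed
    then show ?thesis by (auto simp: E_def)
  qed
  show ?thesis
  proof (intro exI[of _ l] allI impI)
    fix u v assume uv: "{u, v} \<in> edges G" "u \<in> reachable_from G w" "v \<in> reachable_from G w"
    then have "{u, v} \<in> E" by (simp add: E_def)
    then show "l {u, v} \<in> L {u, v} \<and> prod l {e \<in> edges G. u \<in> e} \<noteq> prod l {e \<in> edges G. v \<in> e}"
      using bspec[OF l] inc[OF uv(2)] inc[OF uv(3)] by metis
  qed
qed

theorem theorem3p10:
  fixes G :: "'a graph"
  assumes "finite_simple_graph G"
    and "nice G"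
    and "subcubic G"
  shows "ch_Pi_star G \<le> 4"
proof -
  have card2: "card e = 2" if "e \<in> edges G" for e
    using that assms(1) by (auto simp: finite_simple_graph_def)
  have "\<exists>l. list_labelling G L l \<and> p_proper G l"
    if L: "list_assignment G 4 L" "\<forall>e\<in>edges G. 0 \<notin> L e" for L
  proof -
    let ?P = "\<lambda>K l. \<forall>u v. {u, v} \<in> edges G \<longrightarrow> u \<in> K \<longrightarrow> v \<in> K \<longrightarrow>
      l {u, v} \<in> L {u, v} \<and> prod l {e \<in> edges G. u \<in> e} \<noteq> prod l {e \<in> edges G. v \<in> e}"
    \<comment> \<open>The choice depends on the vertex set of the component and not on a
      representative vertex, so all vertices of a component share one labelling.\<close>
    define lab where "lab K = (SOME l. ?P K l)" for K
    have lab: "?P (reachable_from G w) (lab (reachable_from G w))" for w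
      unfolding lab_def using component_labelling[OF assms L, of w] by (rule someI_ex)
    \<comment> \<open>For an edge of \<open>G\<close> both ends reach the same set, so this union is
      the vertex set of its component.\<close>
    define l where "l e = lab (\<Union>v\<in>e. reachable_from G v) e" for e
    have edge: "v \<in> reachable_from G u" "reachable_from G u = reachable_from G v"
      if "{u, v} \<in> edges G" for u v
    proof -
      show v: "v \<in> reachable_from G u" using reachable_from_step[OF reachable_from_refl that] .
      show "reachable_from G u = reachable_from G v" using reachable_from_eq[OF v] by simp
    qed
    have l_edge: "l {u, v} = lab (reachable_from G u) {u, v}" if "{u, v} \<in> edges G" for u v
      using edge(2)[OF that] by (simp add: l_def)
    have prod_l: "vertex_product G l u = prod (lab (reachable_from G u)) {e \<in> edges G. u \<in> e}" for u
      unfolding vertex_product_eq[OF assms(1)]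
    proof (intro prod.cong refl)
      fix e assume e: "e \<in> {e \<in> edges G. u \<in> e}"
      then have "card e = 2" using card2 by simp
      then obtain v where "e = {u, v}" using e by (auto simp: card_2_iff)
      then show "l e = lab (reachable_from G u) e" using l_edge e by simp
    qed
    have "list_labelling G L l"
      unfolding list_labelling_def
    proof
      fix e assume e: "e \<in> edges G"
      then obtain u v where uv: "e = {u, v}" using card2[OF e] by (auto simp: card_2_iff)
      then show "l e \<in> L e" using lab[of u] edge(1)[of u v] reachable_from_refl[of u G] l_edge[of u v] e
        by auto
    qed
    moreover have "p_proper G l"
      unfolding p_proper_def
    proof (intro allI impI)
      fix u v assume uv: "{u, v} \<in> edges G"
      have "prod (lab (reachable_from G u)) {e \<in> edges G. u \<in> e}
          \<noteq> prod (lab (reachable_from G u)) {e \<in> edges G. v \<in> e}"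
        using lab[of u] edge(1)[OF uv] reachable_from_refl[of u G] uv by blast
      then show "vertex_product G l u \<noteq> vertex_product G l v"
        using prod_l[of u] prod_l[of v] edge(2)[OF uv] by simp
    qed
    ultimately show ?thesis by blast
  qed
  then have "enat 4 \<in> enat ` {k. 1 \<le> k \<and>
     (\<forall>L. list_assignment G k L \<and> (\<forall>e \<in> edges G. 0 \<notin> L e) \<longrightarrow>
       (\<exists>l. list_labelling G L l \<and> p_proper G l))}" by auto
  then have "ch_Pi_star G \<le> enat 4" unfolding ch_Pi_star_def by (rule Inf_lower)
  then show ?thesis by (simp add: numeral_eq_enat)
qed

end
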